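(* Let $M\subseteq V$ and let $\{A,B,C\}$ be a partition of $M$. Consider the following three properties of the table $\mathfrak{X}_M$: 1. $\mathfrak{X}_M$ is strictly collapsible with respect to $\lambda_{B'}^{ABC}$ and $\lambda_{C'}^{ABC}$, for all nonempty $B'\subseteq B$ and $C'\subseteq C$, by collapsing over $\mathfrak{X}_{A}$ into $\mathfrak{X}_{BC}$; 2. $\mathfrak{X}_M$ is strictly collapsible with respect to $\lambda_{A'}^{ABC}$ and $\lambda_{C'}^{ABC}$, for all nonempty $A'\subseteq A$ and $C'\subseteq C$, by collapsing over $\mathfrak{X}_{B}$ into $\mathfrak{X}_{AC}$; 3. $\mathfrak{X}_M$ is strictly collapsible with respect to $\lambda_{A'}^{ABC}$ and $\lambda_{B'}^{ABC}$, for all nonempty $A'\subseteq A$ and $B'\subseteq B$, by collapsing over $\mathfrak{X}_{C}$ into $\mathfrak{X}_{AB}$. For any choice of two of these three properties, both chosen properties hold if and only if $X_{A}\perp\!\!\!\perp X_{B}\perp\!\!\!\perp X_{C}$.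
   Context: $V$ is a finite index set; for $v\in V$, $X_v$ is a categorical variable with finite level set $\mathfrak{X}_v=\{0,1,\dots,|\mathfrak{X}_v|-1\}$. For $A\subseteq V$, $X_A=(X_v)_{v\in A}$ and $\mathfrak{X}_A=\prod_{v\in A}\mathfrak{X}_v$ (with $|\mathfrak{X}_\emptyset|=1$); for $x\in\mathfrak{X}_A$ and $B\subseteq A$, $x_B$ is the restriction of $x$ to $B$. The joint distribution $p=p_V$ of $X_V$ on $\mathfrak{X}_V$ is strictly positive, and $p_A$ denotes its marginal on $\mathfrak{X}_A$. Juxtaposition denotes union: $ST=S\cup T$. The symbol $\subset$ denotes strict inclusion. For $L\subseteq M\subseteq V$ and $x_L\in\mathfrak{X}_L$, define $$\nu_L^M(x_L)=\frac{1}{|\mathfrak{X}_{M\setminus L}|}\sum_{j_M\in\mathfrak{X}_M:\,j_L=x_L}\log p_M(j_M),\qquad \lambda_L^M(x_L)=\sum_{L'\subseteq L}(-1)^{|L\setminus L'|}\nu_{L'}^M(x_{L'}).$$ $\lambda_L^M$ is called a marginal log-linear (MLL) parameter. For $\emptyset\ne L\subseteq K\subset M\subseteq V$, the table $\mathfrak{X}_M$ is strictly collapsible over $M\setminus K$ (also written: over $\mathfrak{X}_{M\setminus K}$) into $\mathfrak{X}_K$ with respect to $\lambda_L^M$ if (i) $\lambda_L^K(x_L)=\lambda_L^M(x_L)$ for all $x_L\in\mathfrak{X}_L$, and (ii) $\lambda_Z^M(x_Z)=0$ for all $x_Z\in\mathfrak{X}_Z$ and all $Z\subseteq M$ with $L\subset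 Z\not\subseteq K$. For a partition $\{A,B,C\}$ of $M$, $X_A\perp\!\!\!\perp X_B\perp\!\!\!\perp X_C$ (mutual independence) means $p_M(x_M)=p_A(x_A)\,p_B(x_B)\,p_C(x_C)$ for all $x_M\in\mathfrak{X}_M$. *)

theory Defs
  imports "HOL-Probability.Probability_Mass_Function" "HOL-Library.Disjoint_Sets"
begin

text \<open>
  The variable \<open>v\<close> has levels \<open>0, \<dots>, d v - 1\<close>. Cells are extensional functions, so
  that the projection of a cell to a subset of its index set is \<^const>\<open>restrict\<close>, and the
  empty table has exactly one cell.
\<close>

definition cells :: "('v \<Rightarrow> nat) \<Rightarrow> 'v set \<Rightarrow> ('v \<Rightarrow> nat) set" where
  "cells d A = (\<Pi>\<^sub>E v\<in>A. {..<d v})"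

definition marginal :: "('v \<Rightarrow> nat) pmf \<Rightarrow> 'v set \<Rightarrow> ('v \<Rightarrow> nat) pmf" where
  "marginal p A = map_pmf (\<lambda>x. restrict x A) p"

definition nu ::
  "('v \<Rightarrow> nat) \<Rightarrow> ('v \<Rightarrow> nat) pmf \<Rightarrow> 'v set \<Rightarrow> 'v set \<Rightarrow> ('v \<Rightarrow> nat) \<Rightarrow> real" where
  "nu d p L M x =
     1 / real (card (cells d (M - L))) *
       (\<Sum>j | j \<in> cells d M \<and> restrict j L = x. ln (pmf (marginal p M) j))"

text \<open>The marginal log-linear parameter \<open>\<lambda>\<^sub>L\<^sup>M(x)\<close>, for a cell \<open>x\<close> of the \<open>L\<close>-table.\<close>

definition mll ::
  "('v \<Rightarrow> nat) \<Rightarrow> ('v \<Rightarrow> nat) pmf \<Rightarrow> 'v set \<Rightarrow> 'v set \<Rightarrow> ('v \<Rightarrow> nat) \<Rightarrow> real" where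
  "mll d p L M x =
     (\<Sum>L'\<in>Pow L. (-1) ^ card (L - L') * nu d p L' M (restrict x L'))"

text \<open>
  The \<open>M\<close>-table is strictly collapsible over \<open>M - K\<close> into the \<open>K\<close>-table with respect to
  \<open>\<lambda>\<^sub>L\<^sup>M\<close>. The first three conjuncts are the standing restrictions under which the notion is
  defined.
\<close>

definition strictly_collapsible ::
  "('v \<Rightarrow> nat) \<Rightarrow> ('v \<Rightarrow> nat) pmf \<Rightarrow> 'v set \<Rightarrow> 'v set \<Rightarrow> 'v set \<Rightarrow> bool" where
  "strictly_collapsible d p L K M \<longleftrightarrow>
     L \<noteq> {} \<and> L \<subseteq> K \<and> K \<subset> M \<and>
     (\<forall>x\<in>cells d L. mll d p L K x = mll d p L M x) \<and>
     (\<forall>Z. Z \<subseteq> M \<and> L \<subset> Z \<and> \<not> Z \<subseteq> K \<longrightarrow> (\<forall>x\<in>cells d Z. mll d p Z M x = 0))"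

definition collapsible_into_blocks ::
  "('v \<Rightarrow> nat) \<Rightarrow> ('v \<Rightarrow> nat) pmf \<Rightarrow> 'v set \<Rightarrow> 'v set \<Rightarrow> 'v set \<Rightarrow> bool" where
  "collapsible_into_blocks d p M S T \<longleftrightarrow>
     (\<forall>S'. S' \<noteq> {} \<and> S' \<subseteq> S \<longrightarrow> strictly_collapsible d p S' (S \<union> T) M) \<and>
     (\<forall>T'. T' \<noteq> {} \<and> T' \<subseteq> T \<longrightarrow> strictly_collapsible d p T' (S \<union> T) M)"

definition mutually_independent ::
  "('v \<Rightarrow> nat) \<Rightarrow> ('v \<Rightarrow> nat) pmf \<Rightarrow> 'v set \<Rightarrow> 'v set \<Rightarrow> 'v set \<Rightarrow> bool" where
  "mutually_independent d p A B C \<longleftrightarrow>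
     (\<forall>x\<in>cells d (A \<union> B \<union> C).
        pmf (marginal p (A \<union> B \<union> C)) x =
          pmf (marginal p A) (restrict x A) *
          pmf (marginal p B) (restrict x B) *
          pmf (marginal p C) (restrict x C))"

end

theory Submission
  imports Defs
begin

text \<open>
  Each of the three collapsibility properties turns out to be a two-block independence: the table
  is collapsible over \<open>R\<close> into \<open>S \<union> T\<close>, with respect to all the parameters that belong to \<open>S\<close> or to
  \<open>T\<close>, exactly when \<open>X\<^sub>R\<close> is independent of \<open>(X\<^sub>S, X\<^sub>T)\<close>
  (\<open>collapsible_into_blocks_iff_independent\<close>). Two of the statements "\<open>A\<close> is independent of
  \<open>BC\<close>", "\<open>B\<close> is independent of \<open>AC\<close>", "\<open>C\<close> is independent of \<open>AB\<close>" together mean mutual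
  independence (\<open>mutually_independent_iff_independent\<close>), because the first gives
  \<open>p\<^sub>M = p\<^sub>A p\<^sub>B\<^sub>C\<close> and summing the second over the cells of \<open>A\<close> gives \<open>p\<^sub>B\<^sub>C = p\<^sub>B p\<^sub>C\<close>.

  The two-block equivalence rests on the link between interactions and factorization. By Moebius
  inversion the parameters \<open>\<lambda>\<^sub>L\<^sup>M\<close>, for \<open>L \<subseteq> M\<close>, sum to \<open>ln p\<^sub>M\<close>
  (\<open>ln_marginal_eq_sum_mll\<close>). Write \<open>K = S \<union> T\<close>. Suppose that the table is collapsible over
  \<open>R\<close>. A set \<open>Z\<close> that meets both \<open>R\<close> and \<open>K\<close> strictly contains some singleton
  \<open>{s}\<close> with \<open>s \<in> K\<close>, so strict collapsibility with respect to \<open>{s}\<close> makes \<open>\<lambda>\<^sub>Z\<^sup>M\<close> vanish.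
  The sum that remains splits into a function of \<open>x\<^sub>R\<close> and a function of \<open>x\<^sub>K\<close>, hence
  \<open>p\<^sub>M\<close> factorizes. Conversely, if \<open>p\<^sub>M = p\<^sub>R p\<^sub>K\<close>, then \<open>\<nu>\<^sub>L\<^sup>M\<close> is the sum of
  \<open>\<nu>\<close>-terms of the \<open>R\<close>-table and of the \<open>K\<close>-table that see \<open>L\<close> only through
  \<open>L \<inter> R\<close> and \<open>L \<inter> K\<close>. An alternating sum over the subsets of \<open>Z\<close> kills every term that ignores
  some element of \<open>Z\<close>, so \<open>\<lambda>\<^sub>Z\<^sup>M\<close> is \<open>\<lambda>\<^sub>Z\<^sup>K\<close> for nonempty \<open>Z \<subseteq> K\<close> and is \<open>0\<close>
  if \<open>Z\<close> meets both blocks (\<open>mll_Un_if_independent\<close>); these are the two clauses of strict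
  collapsibility.
\<close>

section \<open>Alternating sums over subsets\<close>

text \<open>
  Subsets of \<open>Z\<close> pair up as \<open>L\<close>, \<open>insert t L\<close>; the two members of a pair have the same value
  under \<open>g\<close> and opposite signs.
\<close>

lemma sum_alternating_subsets_eq_0:
  fixes g :: "'v set \<Rightarrow> real"
  assumes "finite Z" "t \<in> Z" and g: "\<And>L. g (insert t L) = g L"
  shows "(\<Sum>L\<in>Pow Z. (-1) ^ card (Z - L) * g L) = 0"
proof -
  obtain Y where Y: "Z = insert t Y" "t \<notin> Y" "finite Y"
    using assms by (metis Set.set_insert finite_insert)
  have inj: "inj_on (insert t) (Pow Y)"
    using Y(2) by (auto simp: inj_on_def)
  have disj: "Pow Y \<inter> insert t ` Pow Y = {}"
    using Y(2) by auto
  have sgn: "(-1::real) ^ card (insert t Y - L) = - ((-1) ^ card (insert t Y - insert t L))"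
    if "L \<subseteq> Y" for L
  proof -
    have "insert t Y - L = insert t (Y - L)" "insert t Y - insert t L = Y - L"
      using that Y(2) by auto
    then show ?thesis
      using Y by simp
  qed
  show ?thesis
    unfolding Y(1) Pow_insert using Y(3) disj
    by (simp add: sum.union_disjoint sum.reindex[OF inj] g sgn sum_negf)
qed

text \<open>
  Moebius inversion on a Boolean lattice: up to the sign \<open>(-1) ^ card L\<close>, the inner sum is the
  transform of \<open>g\<close> under an involution, which is the library's symmetric form of
  inclusion-exclusion.
\<close>

lemma sum_subsets_moebius:
  fixes g :: "'v set \<Rightarrow> real"
  assumes "finite M"
  shows "(\<Sum>L\<in>Pow M. \<Sum>L'\<in>Pow L. (-1) ^ card (L - L') * g L') = g M"
proof -
  have "g M = (\<Sum>L\<in>Pow M. (-1) ^ card L * (\<Sum>L'\<in>Pow L. (-1) ^ card L' * g L'))"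
    by (rule inclusion_exclusion_symmetric[OF _ assms]) simp
  also have "\<dots> = (\<Sum>L\<in>Pow M. \<Sum>L'\<in>Pow L. (-1) ^ card (L - L') * g L')"
  proof (intro sum.cong refl)
    fix L assume "L \<in> Pow M"
    then have fin: "finite L"
      using assms finite_subset by auto
    have "(-1::real) ^ card L * (-1) ^ card L' = (-1) ^ card (L - L')" if "L' \<subseteq> L" for L'
    proof -
      have "card (L - L') = card L - card L'" "card L' \<le> card L"
        using that fin by (auto intro: card_Diff_subset card_mono finite_subset)
      then show ?thesis
        by (simp add: power_add[symmetric] neg_one_power_add_eq_neg_one_power_diff)
    qed
    then show "(-1) ^ card L * (\<Sum>L'\<in>Pow L. (-1) ^ card L' * g L')
        = (\<Sum>L'\<in>Pow L. (-1) ^ card (L - L') * g L')"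
      by (simp add: sum_distrib_left mult.assoc[symmetric])
  qed
  finally show ?thesis ..
qed

section \<open>Cells of a disjoint union\<close>

lemma finite_cells: "finite A \<Longrightarrow> finite (cells d A)"
  by (simp add: cells_def finite_PiE)

lemma restrict_in_cells: "x \<in> cells d A \<Longrightarrow> B \<subseteq> A \<Longrightarrow> restrict x B \<in> cells d B"
  by (auto simp: cells_def)

lemma restrict_cells_same: "x \<in> cells d A \<Longrightarrow> restrict x A = x"
  by (auto simp: cells_def PiE_restrict)

text \<open>
  A cell of \<open>A\<close> extends to \<open>V\<close> only if no variable outside \<open>A\<close> has an empty level set; one
  existing cell \<open>w\<close> of \<open>V\<close> supplies the missing coordinates.
\<close>

lemma restrict_image_cells:
  assumes "cells d V \<noteq> {}" "A \<subseteq> V"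
  shows "(\<lambda>x. restrict x A) ` cells d V = cells d A"
proof
  show "(\<lambda>x. restrict x A) ` cells d V \<subseteq> cells d A"
    using assms by (auto intro: restrict_in_cells)
  obtain w where w: "w \<in> cells d V"
    using assms by blast
  show "cells d A \<subseteq> (\<lambda>x. restrict x A) ` cells d V"
  proof
    fix y assume y: "y \<in> cells d A"
    let ?z = "\<lambda>v. if v \<in> A then y v else w v"
    have z: "?z \<in> cells d V"
      using y w assms(2) by (auto simp: cells_def PiE_iff extensional_def)
    have zA: "restrict ?z A = y"
      using restrict_cells_same[OF y] restrict_ext[of A ?z y] by simp
    show "y \<in> (\<lambda>x. restrict x A) ` cells d V"
      using imageI[OF z, of "\<lambda>x. restrict x A"] unfolding zA .
  qed
qed

lemma cells_nonempty_subset: "cells d V \<noteq> {} \<Longrightarrow> A \<subseteq> V \<Longrightarrow> cells d A \<noteq> {}"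
  using restrict_image_cells by blast

lemma card_cells_pos: "finite A \<Longrightarrow> cells d A \<noteq> {} \<Longrightarrow> card (cells d A) > 0"
  by (simp add: card_gt_0_iff finite_cells)

lemma card_cells_Un:
  assumes "finite A" "finite B" "A \<inter> B = {}"
  shows "card (cells d (A \<union> B)) = card (cells d A) * card (cells d B)"
  using assms by (simp add: cells_def card_PiE prod.union_disjoint)

lemma merge_restrict_cells:
  "x \<in> cells d (A \<union> B) \<Longrightarrow> merge A B (restrict x A, restrict x B) = x"
  by (simp add: restrict_cells_same)

lemma bij_betw_cells_merge:
  assumes "A \<inter> B = {}"
  shows "bij_betw (merge A B) (cells d A \<times> cells d B) (cells d (A \<union> B))"
proof (rule bij_betw_byWitness[where f' = "\<lambda>x. (restrict x A, restrict x B)"])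
  show "\<forall>u\<in>cells d A \<times> cells d B. (restrict (merge A B u) A, restrict (merge A B u) B) = u"
    using assms by (auto simp: restrict_cells_same)
  show "\<forall>x\<in>cells d (A \<union> B). merge A B (restrict x A, restrict x B) = x"
    using merge_restrict_cells by blast
  show "merge A B ` (cells d A \<times> cells d B) \<subseteq> cells d (A \<union> B)"
    using assms by (auto simp: cells_def PiE_iff merge_def extensional_def)
  show "(\<lambda>x. (restrict x A, restrict x B)) ` cells d (A \<union> B) \<subseteq> cells d A \<times> cells d B"
    by (auto intro: restrict_in_cells)
qed

lemma restrict_merge_cells:
  assumes "A \<inter> B = {}" "i \<in> cells d A" "k \<in> cells d B"
  shows "restrict (merge A B (i, k)) A = i" "restrict (merge A B (i, k)) B = k"
    "merge A B (i, k) \<in> cells d (A \<union> B)"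
  using assms restrict_cells_same[OF assms(2)] restrict_cells_same[OF assms(3)]
    bij_betwE[OF bij_betw_cells_merge[OF assms(1), of d]] by simp_all

text \<open>
  This parametrization of the cells with a prescribed projection serves both to marginalize a
  distribution and to count cells.
\<close>

lemma bij_betw_cells_fibre:
  assumes "A \<inter> B = {}" "i \<in> cells d A"
  shows "bij_betw (\<lambda>k. merge A B (i, k)) (cells d B) {x \<in> cells d (A \<union> B). restrict x A = i}"
proof (rule bij_betw_byWitness[where f' = "\<lambda>x. restrict x B"])
  show "\<forall>x\<in>{x \<in> cells d (A \<union> B). restrict x A = i}. merge A B (i, restrict x B) = x"
    using merge_restrict_cells by blast
  show "\<forall>k\<in>cells d B. restrict (merge A B (i, k)) B = k"
    using restrict_merge_cells(2)[OF assms] by blast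
  show "(\<lambda>k. merge A B (i, k)) ` cells d B \<subseteq> {x \<in> cells d (A \<union> B). restrict x A = i}"
    using restrict_merge_cells[OF assms] by blast
  show "(\<lambda>x. restrict x B) ` {x \<in> cells d (A \<union> B). restrict x A = i} \<subseteq> cells d B"
    by (auto intro: restrict_in_cells)
qed

lemma sum_cells_Un:
  assumes "A \<inter> B = {}"
  shows "(\<Sum>x\<in>cells d (A \<union> B). f x) = (\<Sum>i\<in>cells d A. \<Sum>k\<in>cells d B. f (merge A B (i, k)))"
  by (simp only: sum.reindex_bij_betw[OF bij_betw_cells_merge[OF assms], symmetric]
      sum.cartesian_product case_prod_eta split_def prod.collapse)

section \<open>Margins and independence\<close>

definition independent ::
  "('v \<Rightarrow> nat) \<Rightarrow> ('v \<Rightarrow> nat) pmf \<Rightarrow> 'v set \<Rightarrow> 'v set \<Rightarrow> bool" where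
  "independent d p A B \<longleftrightarrow>
     (\<forall>x\<in>cells d (A \<union> B). pmf (marginal p (A \<union> B)) x =
        pmf (marginal p A) (restrict x A) * pmf (marginal p B) (restrict x B))"

lemma set_pmf_marginal:
  assumes "set_pmf p = cells d V" "A \<subseteq> V"
  shows "set_pmf (marginal p A) = cells d A"
  using restrict_image_cells[of d V A] assms set_pmf_not_empty[of p]
  by (simp add: marginal_def)

lemma pmf_marginal_pos:
  assumes "set_pmf p = cells d V" "A \<subseteq> V" "x \<in> cells d A"
  shows "pmf (marginal p A) x > 0"
  using assms set_pmf_marginal by (metis pmf_positive)

lemma sum_pmf_marginal:
  assumes "finite V" "set_pmf p = cells d V" "A \<subseteq> V"
  shows "(\<Sum>x\<in>cells d A. pmf (marginal p A) x) = 1"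
  using assms set_pmf_marginal[OF assms(2,3)]
  by (intro sum_pmf_eq_1 finite_cells) (auto intro: finite_subset)

lemma pmf_marginal_eq_sum:
  assumes "finite V" "set_pmf p = cells d V" "A \<union> B \<subseteq> V" "A \<inter> B = {}" "i \<in> cells d A"
  shows "pmf (marginal p A) i = (\<Sum>k\<in>cells d B. pmf (marginal p (A \<union> B)) (merge A B (i, k)))"
proof -
  let ?q = "marginal p (A \<union> B)"
  have set: "set_pmf ?q = cells d (A \<union> B)"
    using set_pmf_marginal[OF assms(2,3)] .
  have "finite (cells d (A \<union> B))"
    using assms by (auto intro: finite_cells finite_subset)
  then have fin: "finite {x \<in> cells d (A \<union> B). restrict x A = i}"
    by simp
  have fibre: "(\<lambda>x. restrict x A) -` {i} \<inter> cells d (A \<union> B)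
      = {x \<in> cells d (A \<union> B). restrict x A = i}"
    by auto
  have "marginal p A = map_pmf (\<lambda>x. restrict x A) ?q"
    by (simp add: marginal_def map_pmf_comp Int_absorb1)
  then have "pmf (marginal p A) i = measure_pmf.prob ?q ((\<lambda>x. restrict x A) -` {i})"
    by (simp add: pmf_map)
  also have "\<dots> = measure_pmf.prob ?q ((\<lambda>x. restrict x A) -` {i} \<inter> set_pmf ?q)"
    by (simp add: measure_Int_set_pmf)
  also have "\<dots> = (\<Sum>x | x \<in> cells d (A \<union> B) \<and> restrict x A = i. pmf ?q x)"
    unfolding set fibre by (rule measure_measure_pmf_finite[OF fin])
  also have "\<dots> = (\<Sum>k\<in>cells d B. pmf ?q (merge A B (i, k)))"
    by (rule sum.reindex_bij_betw[OF bij_betw_cells_fibre[OF assms(4,5)], symmetric])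
  finally show ?thesis .
qed

text \<open>
  The factors need not be normalized: the marginals are \<open>F\<close> times the total of \<open>G\<close> and \<open>G\<close>
  times the total of \<open>F\<close>, and the product of the two totals is \<open>1\<close> because the probabilities
  add up to \<open>1\<close>.
\<close>

lemma independent_if_factorizes:
  assumes V: "finite V" "set_pmf p = cells d V" "A \<union> B \<subseteq> V" and disj: "A \<inter> B = {}"
    and fac: "\<And>x. x \<in> cells d (A \<union> B) \<Longrightarrow>
      pmf (marginal p (A \<union> B)) x = F (restrict x A) * G (restrict x B)"
  shows "independent d p A B"
proof -
  let ?F = "\<Sum>i\<in>cells d A. F i" and ?G = "\<Sum>k\<in>cells d B. G k"
  have pA: "pmf (marginal p A) i = F i * ?G" if "i \<in> cells d A" for i
    using that disj
    by (simp add: pmf_marginal_eq_sum[OF V disj] fac restrict_merge_cells sum_distrib_left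
        restrict_cells_same)
  have pB: "pmf (marginal p B) k = G k * ?F" if k: "k \<in> cells d B" for k
  proof -
    have "pmf (marginal p B) k = (\<Sum>i\<in>cells d A. pmf (marginal p (A \<union> B)) (merge B A (k, i)))"
      using pmf_marginal_eq_sum[OF V(1,2), of B A k] V(3) disj k by (simp add: ac_simps)
    also have "\<dots> = (\<Sum>i\<in>cells d A. G k * F i)"
    proof (rule sum.cong[OF refl])
      fix i assume "i \<in> cells d A"
      with restrict_merge_cells[of B A k d i] k disj fac[of "merge B A (k, i)"]
      show "pmf (marginal p (A \<union> B)) (merge B A (k, i)) = G k * F i"
        by (simp add: ac_simps)
    qed
    finally show ?thesis
      by (simp add: sum_distrib_left)
  qed
  have "1 = (\<Sum>i\<in>cells d A. F i * ?G)"
    using sum_pmf_marginal[OF V(1,2), of A] V(3) by (simp add: pA)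
  then have "?F * ?G = 1"
    by (simp add: sum_distrib_right)
  then have "F i * G k = F i * G k * (?F * ?G)" for i k
    by simp
  then have "F i * G k = F i * ?G * (G k * ?F)" for i k
    by (simp only: ac_simps)
  then show ?thesis
    unfolding independent_def by (auto simp: fac pA pB restrict_in_cells)
qed

text \<open>
  From right to left, fixing the cells of \<open>B\<close> and \<open>C\<close> and summing
  \<open>p\<^sub>A\<^sub>B\<^sub>C = p\<^sub>B p\<^sub>A\<^sub>C\<close> over the cells of \<open>A\<close> gives \<open>p\<^sub>B\<^sub>C = p\<^sub>B p\<^sub>C\<close>, which is
  substituted into \<open>p\<^sub>A\<^sub>B\<^sub>C = p\<^sub>A p\<^sub>B\<^sub>C\<close>. From left to right, the product of three
  marginals is read as a factorization into two blocks.
\<close>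

lemma mutually_independent_iff_independent:
  assumes V: "finite V" "set_pmf p = cells d V" "A \<union> B \<union> C \<subseteq> V"
    and disj: "A \<inter> B = {}" "A \<inter> C = {}" "B \<inter> C = {}"
  shows "mutually_independent d p A B C \<longleftrightarrow>
    independent d p A (B \<union> C) \<and> independent d p B (A \<union> C)"
proof (intro iffI conjI)
  assume mi: "mutually_independent d p A B C"
  show "independent d p A (B \<union> C)"
    using mi V disj
    by (intro independent_if_factorizes[where V = V and F = "\<lambda>y. pmf (marginal p A) y"
          and G = "\<lambda>z. pmf (marginal p B) (restrict z B) * pmf (marginal p C) (restrict z C)"])
      (auto simp: mutually_independent_def Un_assoc Int_absorb1)
  have BAC: "B \<union> (A \<union> C) = A \<union> B \<union> C"
    by auto
  show "independent d p B (A \<union> C)"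
    using mi V disj
    by (intro independent_if_factorizes[where V = V and F = "\<lambda>y. pmf (marginal p B) y"
          and G = "\<lambda>z. pmf (marginal p A) (restrict z A) * pmf (marginal p C) (restrict z C)"])
      (auto simp: mutually_independent_def BAC Int_absorb1)
next
  assume ind: "independent d p A (B \<union> C) \<and> independent d p B (A \<union> C)"
  have M: "B \<union> C \<union> A = A \<union> B \<union> C" "B \<union> (A \<union> C) = A \<union> B \<union> C" "A \<union> (B \<union> C) = A \<union> B \<union> C"
    by auto
  have pBC: "pmf (marginal p (B \<union> C)) z
      = pmf (marginal p B) (restrict z B) * pmf (marginal p C) (restrict z C)"
    if z: "z \<in> cells d (B \<union> C)" for z
  proof -
    have d1: "(B \<union> C) \<inter> A = {}" "C \<inter> A = {}"
      using disj by auto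
    have zB: "restrict z B \<in> cells d B" and zC: "restrict z C \<in> cells d C"
      using z by (auto intro: restrict_in_cells)
    have "pmf (marginal p (B \<union> C)) z
        = (\<Sum>i\<in>cells d A. pmf (marginal p (A \<union> B \<union> C)) (merge (B \<union> C) A (z, i)))"
      using pmf_marginal_eq_sum[OF V(1,2), of "B \<union> C" A z] V(3) d1 z by (simp add: M)
    also have "\<dots> = (\<Sum>i\<in>cells d A. pmf (marginal p B) (restrict z B) *
        pmf (marginal p (A \<union> C)) (merge C A (restrict z C, i)))"
    proof (rule sum.cong[OF refl])
      fix i assume i: "i \<in> cells d A"
      let ?x = "merge (B \<union> C) A (z, i)"
      have "?x \<in> cells d (A \<union> B \<union> C)"
        using restrict_merge_cells(3)[OF d1(1) z i] by (simp add: M)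
      moreover have "restrict ?x B = restrict z B"
        by (auto simp: merge_def restrict_def fun_eq_iff)
      moreover have "restrict ?x (A \<union> C) = merge C A (restrict z C, i)"
        using disj by (auto simp: merge_def restrict_def fun_eq_iff)
      ultimately show "pmf (marginal p (A \<union> B \<union> C)) ?x
          = pmf (marginal p B) (restrict z B) *
            pmf (marginal p (A \<union> C)) (merge C A (restrict z C, i))"
        using conjunct2[OF ind] by (simp add: independent_def M)
    qed
    also have "\<dots> = pmf (marginal p B) (restrict z B) * pmf (marginal p C) (restrict z C)"
      using pmf_marginal_eq_sum[OF V(1,2), of C A "restrict z C"] V(3) d1 zC
      by (simp add: sum_distrib_left Un_commute)
    finally show ?thesis .
  qed
  show "mutually_independent d p A B C"
    unfolding mutually_independent_def
  proof
    fix x assume x: "x \<in> cells d (A \<union> B \<union> C)"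
    then have z: "restrict x (B \<union> C) \<in> cells d (B \<union> C)"
      by (auto intro: restrict_in_cells)
    show "pmf (marginal p (A \<union> B \<union> C)) x = pmf (marginal p A) (restrict x A) *
        pmf (marginal p B) (restrict x B) * pmf (marginal p C) (restrict x C)"
      using conjunct1[OF ind] x pBC[OF z] by (simp add: independent_def M Int_absorb1)
  qed
qed

section \<open>Marginal log-linear parameters of a product distribution\<close>

text \<open>
  This is the log-linear expansion of the table. Moebius inversion leaves the term
  \<open>\<nu>\<^sub>M\<^sup>M(x)\<close>, an average over the single cell \<open>x\<close>.
\<close>

lemma ln_marginal_eq_sum_mll:
  assumes "finite M" "x \<in> cells d M"
  shows "(\<Sum>L\<in>Pow M. mll d p L M (restrict x L)) = ln (pmf (marginal p M) x)"
proof -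
  have top: "{j. j \<in> cells d M \<and> restrict j M = x} = {x}"
    using assms(2) by (auto simp: restrict_cells_same)
  have "(\<Sum>L\<in>Pow M. mll d p L M (restrict x L)) =
      (\<Sum>L\<in>Pow M. \<Sum>L'\<in>Pow L. (-1) ^ card (L - L') * nu d p L' M (restrict x L'))"
    by (auto simp: mll_def Int_absorb1 intro!: sum.cong)
  also have "\<dots> = nu d p M M (restrict x M)"
    using assms(1) by (rule sum_subsets_moebius)
  also have "\<dots> = ln (pmf (marginal p M) x)"
    using assms(2) by (simp add: nu_def restrict_cells_same top) (simp add: cells_def)
  finally show ?thesis .
qed

text \<open>
  For \<open>f = ln p\<^sub>M\<close> this is \<open>\<nu>\<^sub>L\<^sup>M\<close>. A general \<open>f\<close> is allowed because the logarithm of a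
  product distribution is a sum of two functions that have to be averaged separately.
\<close>

definition cell_mean ::
  "('v \<Rightarrow> nat) \<Rightarrow> 'v set \<Rightarrow> 'v set \<Rightarrow> (('v \<Rightarrow> nat) \<Rightarrow> real) \<Rightarrow> ('v \<Rightarrow> nat) \<Rightarrow> real" where
  "cell_mean d L M f x =
     1 / real (card (cells d (M - L))) * (\<Sum>j | j \<in> cells d M \<and> restrict j L = x. f j)"

lemma card_cells_fibre:
  assumes "L \<subseteq> T" "y \<in> cells d L"
  shows "card {k \<in> cells d T. restrict k L = y} = card (cells d (T - L))"
proof -
  have disj: "L \<inter> (T - L) = {}" and Un: "L \<union> (T - L) = T"
    using assms(1) by auto
  show ?thesis
    using bij_betw_same_card[OF bij_betw_cells_fibre[OF disj assms(2)]] unfolding Un by simp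
qed

text \<open>
  The cells of \<open>S \<union> T\<close> over \<open>x\<close> are the pairs of a cell of \<open>S\<close> over \<open>x\<^sub>L\<^sub>\<inter>\<^sub>S\<close> and a cell of
  \<open>T\<close> over \<open>x\<^sub>L\<^sub>\<inter>\<^sub>T\<close>. A function of the first component is summed as often as there are second
  components, and the same number occurs in the normalizing constant; it cancels since it is not
  zero, which is where \<open>cells d T \<noteq> {}\<close> enters.
\<close>

lemma cell_mean_restrict:
  assumes fin: "finite S" "finite T" and disj: "S \<inter> T = {}" and ne: "cells d T \<noteq> {}"
    and L: "L \<subseteq> S \<union> T" and x: "x \<in> cells d L"
  shows "cell_mean d L (S \<union> T) (\<lambda>j. a (restrict j S)) x
    = cell_mean d (L \<inter> S) S a (restrict x (L \<inter> S))"
proof -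
  let ?y = "restrict x (L \<inter> S)" and ?z = "restrict x (L \<inter> T)"
  let ?I = "{i \<in> cells d S. restrict i (L \<inter> S) = ?y}"
    and ?K = "{k \<in> cells d T. restrict k (L \<inter> T) = ?z}"
  have fI: "finite (cells d S)" and fK: "finite (cells d T)"
    using fin by (auto intro: finite_cells)
  have eq: "restrict (merge S T (i, k)) L = x \<longleftrightarrow>
      restrict i (L \<inter> S) = ?y \<and> restrict k (L \<inter> T) = ?z" (is "?l \<longleftrightarrow> ?r")
    for i k
  proof
    assume l: ?l
    show ?r
      unfolding l[symmetric] using disj by (auto simp: merge_def restrict_def fun_eq_iff)
  next
    assume r: ?r
    show ?l
    proof
      fix v
      show "restrict (merge S T (i, k)) L v = x v"
      proof (cases "v \<in> L")
        case True
        then show ?thesis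
          using r L disj
          by (auto simp: merge_def restrict_def fun_eq_iff split: if_splits)
      next
        case False
        then show ?thesis
          using x by (auto simp: cells_def PiE_iff extensional_def)
      qed
    qed
  qed
  have "(\<Sum>j | j \<in> cells d (S \<union> T) \<and> restrict j L = x. a (restrict j S))
      = (\<Sum>j\<in>cells d (S \<union> T). if restrict j L = x then a (restrict j S) else 0)"
    using fin by (subst sum.inter_filter[symmetric]) (auto intro: finite_cells)
  also have "\<dots> = (\<Sum>i\<in>cells d S. \<Sum>k\<in>cells d T.
      if restrict i (L \<inter> S) = ?y \<and> restrict k (L \<inter> T) = ?z then a i else 0)"
    using disj by (auto simp: sum_cells_Un eq restrict_merge_cells restrict_cells_same intro!: sum.cong)
  also have "\<dots> = (\<Sum>i\<in>cells d S. if restrict i (L \<inter> S) = ?y then \<Sum>k\<in>?K. a i else 0)"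
    using fK by (intro sum.cong refl) (auto simp flip: sum.inter_filter)
  also have "\<dots> = (\<Sum>i\<in>?I. real (card ?K) * a i)"
    by (simp add: sum.inter_filter[OF fI] cong: if_cong)
  also have "\<dots> = real (card ?K) * (\<Sum>i\<in>?I. a i)"
    by (simp add: sum_distrib_left)
  finally have 1: "(\<Sum>j | j \<in> cells d (S \<union> T) \<and> restrict j L = x. a (restrict j S))
      = real (card ?K) * (\<Sum>i\<in>?I. a i)" .
  have "?z \<in> cells d (L \<inter> T)"
    using x by (auto intro: restrict_in_cells)
  then have 2: "card ?K = card (cells d (T - L))"
    by (subst card_cells_fibre) (auto simp: Diff_Int)
  have "S \<union> T - L = (S - L) \<union> (T - L)"
    by auto
  then have 3: "card (cells d (S \<union> T - L)) = card (cells d (S - L)) * card (cells d (T - L))"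
    using disj fin by (subst card_cells_Un[symmetric]) auto
  have "cells d (T - L) \<noteq> {}"
    using ne by (rule cells_nonempty_subset) auto
  then have "card (cells d (T - L)) > 0"
    using fin by (intro card_cells_pos) auto
  then show ?thesis
    by (simp add: cell_mean_def 1 2 3 Diff_Int)
qed

lemma nu_Un_if_independent:
  assumes V: "finite V" "set_pmf p = cells d V" "S \<union> T \<subseteq> V" and disj: "S \<inter> T = {}"
    and ind: "independent d p S T" and L: "L \<subseteq> S \<union> T" and x: "x \<in> cells d L"
  shows "nu d p L (S \<union> T) x =
    nu d p (L \<inter> S) S (restrict x (L \<inter> S)) + nu d p (L \<inter> T) T (restrict x (L \<inter> T))"
proof -
  let ?a = "\<lambda>A j. ln (pmf (marginal p A) j)"
  have fin: "finite S" "finite T"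
    using V finite_subset by auto
  have ne: "cells d S \<noteq> {}" "cells d T \<noteq> {}"
    using V set_pmf_not_empty[of p] cells_nonempty_subset[of d V] by auto
  have nu: "nu d p A B y = cell_mean d A B (?a B) y" for A B y
    by (simp add: nu_def cell_mean_def)
  have ln: "?a (S \<union> T) j = ?a S (restrict j S) + ?a T (restrict j T)"
    if j: "j \<in> cells d (S \<union> T)" for j
  proof -
    have "restrict j S \<in> cells d S" "restrict j T \<in> cells d T"
      using j by (auto intro: restrict_in_cells)
    then have "pmf (marginal p S) (restrict j S) > 0" "pmf (marginal p T) (restrict j T) > 0"
      using V by (auto intro!: pmf_marginal_pos)
    then show ?thesis
      using ind j by (simp add: independent_def ln_mult)
  qed
  have "nu d p L (S \<union> T) x = cell_mean d L (S \<union> T) (\<lambda>j. ?a S (restrict j S)) x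
      + cell_mean d L (S \<union> T) (\<lambda>j. ?a T (restrict j T)) x"
    by (simp add: nu cell_mean_def ln sum.distrib distrib_left)
  also have "cell_mean d L (S \<union> T) (\<lambda>j. ?a S (restrict j S)) x
      = nu d p (L \<inter> S) S (restrict x (L \<inter> S))"
    unfolding nu using fin(1,2) disj ne(2) L x by (rule cell_mean_restrict)
  also have "cell_mean d L (S \<union> T) (\<lambda>j. ?a T (restrict j T)) x
      = nu d p (L \<inter> T) T (restrict x (L \<inter> T))"
    unfolding nu Un_commute[of S T] using disj ne(1) L x
    by (intro cell_mean_restrict fin) auto
  finally show ?thesis .
qed

text \<open>
  If \<open>Z\<close> has an element outside \<open>S\<close>, then \<open>g (L \<inter> S)\<close> ignores that element and the terms cancel
  in pairs.
\<close>

lemma sum_alternating_restrict: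
  fixes g :: "'v set \<Rightarrow> real"
  assumes "finite Z"
  shows "(\<Sum>L\<in>Pow Z. (-1) ^ card (Z - L) * g (L \<inter> S))
    = (if Z \<subseteq> S then \<Sum>L\<in>Pow Z. (-1) ^ card (Z - L) * g L else 0)"
proof (cases "Z \<subseteq> S")
  case True
  then show ?thesis
    by (auto intro!: sum.cong simp: Int_absorb2 subset_trans)
next
  case False
  then obtain t where "t \<in> Z" "t \<notin> S"
    by auto
  then show ?thesis
    using False assms by (subst sum_alternating_subsets_eq_0[where t = t]) auto
qed

text \<open>
  By additivity of \<open>\<nu>\<close> over the two blocks, \<open>\<lambda>\<^sub>Z\<close> is a sum of two alternating sums, and each of
  them cancels unless \<open>Z\<close> lies inside its block. A set that meets both blocks lies in neither,
  so independent blocks do not interact; both summands are present only for \<open>Z = {}\<close>.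
\<close>

lemma mll_Un_if_independent:
  assumes V: "finite V" "set_pmf p = cells d V" "S \<union> T \<subseteq> V" and disj: "S \<inter> T = {}"
    and ind: "independent d p S T" and Z: "Z \<subseteq> S \<union> T" and x: "x \<in> cells d Z"
  shows "mll d p Z (S \<union> T) x =
    (if Z \<subseteq> S then mll d p Z S x else 0) + (if Z \<subseteq> T then mll d p Z T x else 0)"
proof -
  let ?g = "\<lambda>A L. nu d p L A (restrict x L)"
  have fin: "finite Z"
    using V Z finite_subset by metis
  have "mll d p Z (S \<union> T) x =
      (\<Sum>L\<in>Pow Z. (-1) ^ card (Z - L) * (?g S (L \<inter> S) + ?g T (L \<inter> T)))"
    unfolding mll_def
  proof (rule sum.cong[OF refl])
    fix L assume L: "L \<in> Pow Z"
    have "restrict x L \<in> cells d L"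
      using L x by (auto intro: restrict_in_cells)
    then show "(-1) ^ card (Z - L) * nu d p L (S \<union> T) (restrict x L)
        = (-1) ^ card (Z - L) * (?g S (L \<inter> S) + ?g T (L \<inter> T))"
      using L Z nu_Un_if_independent[OF V disj ind, of L "restrict x L"]
      by (auto simp: Int_assoc[symmetric])
  qed
  also have "\<dots> = (\<Sum>L\<in>Pow Z. (-1) ^ card (Z - L) * ?g S (L \<inter> S))
      + (\<Sum>L\<in>Pow Z. (-1) ^ card (Z - L) * ?g T (L \<inter> T))"
    by (simp add: distrib_left sum.distrib)
  finally show ?thesis
    unfolding sum_alternating_restrict[OF fin, of "?g S" S]
      sum_alternating_restrict[OF fin, of "?g T" T]
    by (simp add: mll_def)
qed

section \<open>Strict collapsibility as independence of two blocks\<close>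

text \<open>
  In the log-linear expansion only sets inside \<open>R\<close> or inside \<open>K\<close> survive; exponentiating
  the two partial sums gives a factorization of the table.
\<close>

lemma independent_if_mll_eq_0:
  assumes V: "finite V" "set_pmf p = cells d V" "R \<union> K \<subseteq> V" and disj: "R \<inter> K = {}"
    and zero: "\<And>Z x. Z \<subseteq> R \<union> K \<Longrightarrow> Z \<inter> R \<noteq> {} \<Longrightarrow> Z \<inter> K \<noteq> {} \<Longrightarrow> x \<in> cells d Z \<Longrightarrow>
      mll d p Z (R \<union> K) x = 0"
  shows "independent d p R K"
proof (rule independent_if_factorizes[OF V disj])
  let ?l = "\<lambda>x Z. mll d p Z (R \<union> K) (restrict x Z)"
  fix x assume x: "x \<in> cells d (R \<union> K)"
  have fin: "finite R" "finite K"
    using V finite_subset by auto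
  have "ln (pmf (marginal p (R \<union> K)) x) = (\<Sum>Z\<in>Pow (R \<union> K). ?l x Z)"
    using ln_marginal_eq_sum_mll[of "R \<union> K" x d p] fin x by simp
  \<comment> \<open>The empty set lies in both power sets; its term is counted with \<open>R\<close>.\<close>
  also have "\<dots> = (\<Sum>Z\<in>Pow R \<union> (Pow K - {{}}). ?l x Z)"
  proof (rule sum.mono_neutral_right)
    show "\<forall>Z\<in>Pow (R \<union> K) - (Pow R \<union> (Pow K - {{}})). ?l x Z = 0"
    proof
      fix Z assume Z: "Z \<in> Pow (R \<union> K) - (Pow R \<union> (Pow K - {{}}))"
      then have "restrict x Z \<in> cells d Z"
        using x by (auto intro: restrict_in_cells)
      with Z show "?l x Z = 0"
        by (intro zero) auto
    qed
  qed (use fin in auto)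
  also have "\<dots> = (\<Sum>Z\<in>Pow R. ?l x Z) + (\<Sum>Z\<in>Pow K - {{}}. ?l x Z)"
    using fin disj by (intro sum.union_disjoint) auto
  also have "\<dots> = (\<Sum>Z\<in>Pow R. ?l (restrict x R) Z) + (\<Sum>Z\<in>Pow K - {{}}. ?l (restrict x K) Z)"
    by (intro arg_cong2[where f = "(+)"] sum.cong refl) (auto simp: Int_absorb1)
  finally have ln: "ln (pmf (marginal p (R \<union> K)) x) = \<dots>" .
  have pos: "pmf (marginal p (R \<union> K)) x > 0"
    using pmf_marginal_pos[OF V(2,3) x] .
  show "pmf (marginal p (R \<union> K)) x =
      (\<lambda>y. exp (\<Sum>Z\<in>Pow R. ?l y Z)) (restrict x R) *
      (\<lambda>y. exp (\<Sum>Z\<in>Pow K - {{}}. ?l y Z)) (restrict x K)"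
    using arg_cong[OF ln, of exp] pos by (simp only: exp_ln exp_add)
qed

lemma strictly_collapsible_if_independent:
  assumes V: "finite V" "set_pmf p = cells d V" "R \<union> K \<subseteq> V" and disj: "R \<inter> K = {}"
    and "R \<noteq> {}" and ind: "independent d p R K" and L: "L \<noteq> {}" "L \<subseteq> K"
  shows "strictly_collapsible d p L K (R \<union> K)"
proof -
  note mll = mll_Un_if_independent[OF V disj ind]
  have LR: "\<not> L \<subseteq> R"
    using L disj by auto
  have "mll d p L (R \<union> K) x = mll d p L K x" if "x \<in> cells d L" for x
    using mll[of L x] that L LR by auto
  moreover have "mll d p Z (R \<union> K) x = 0"
    if "Z \<subseteq> R \<union> K" "L \<subset> Z" "\<not> Z \<subseteq> K" "x \<in> cells d Z" for Z x
    using mll[of Z x] that LR by auto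
  moreover have "K \<subset> R \<union> K"
    using disj \<open>R \<noteq> {}\<close> by auto
  ultimately show ?thesis
    using L unfolding strictly_collapsible_def by auto
qed

text \<open>
  From left to right, singletons are the decisive choice of parameter: the smaller the set, the
  more sets \<open>Z\<close> strictly contain it, and every \<open>Z\<close> that meets \<open>R\<close> and \<open>S \<union> T\<close> strictly contains
  a singleton of \<open>S\<close> or of \<open>T\<close>.
\<close>

lemma collapsible_into_blocks_iff_independent:
  assumes V: "finite V" "set_pmf p = cells d V" "R \<union> (S \<union> T) \<subseteq> V"
    and disj: "R \<inter> (S \<union> T) = {}" and "R \<noteq> {}"
  shows "collapsible_into_blocks d p (R \<union> (S \<union> T)) S T \<longleftrightarrow> independent d p R (S \<union> T)"
proof
  assume col: "collapsible_into_blocks d p (R \<union> (S \<union> T)) S T"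
  show "independent d p R (S \<union> T)"
  proof (rule independent_if_mll_eq_0[OF V disj])
    fix Z x
    assume Z: "Z \<subseteq> R \<union> (S \<union> T)" "Z \<inter> R \<noteq> {}" "Z \<inter> (S \<union> T) \<noteq> {}" and x: "x \<in> cells d Z"
    then obtain s where s: "s \<in> Z" "s \<in> S \<union> T"
      by auto
    have "strictly_collapsible d p {s} (S \<union> T) (R \<union> (S \<union> T))"
      using s(2)
    proof
      assume "s \<in> S" then show ?thesis
        using col unfolding collapsible_into_blocks_def by simp
    next
      assume "s \<in> T" then show ?thesis
        using col unfolding collapsible_into_blocks_def by simp
    qed
    moreover have "{s} \<subset> Z" "\<not> Z \<subseteq> S \<union> T"
      using Z s disj by auto
    ultimately show "mll d p Z (R \<union> (S \<union> T)) x = 0"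
      using Z(1) x unfolding strictly_collapsible_def by simp
  qed
next
  assume "independent d p R (S \<union> T)"
  then show "collapsible_into_blocks d p (R \<union> (S \<union> T)) S T"
    unfolding collapsible_into_blocks_def
    by (auto intro!: strictly_collapsible_if_independent[OF V disj \<open>R \<noteq> {}\<close>])
qed

theorem theorem4p3:
  fixes V M A B C :: "'v set"
    and d :: "'v \<Rightarrow> nat"
    and p :: "('v \<Rightarrow> nat) pmf"
  assumes "finite V"
    and "set_pmf p = cells d V"
    and "M \<subseteq> V"
    and "partition_on M {A, B, C}" and "A \<noteq> B" and "A \<noteq> C" and "B \<noteq> C"
  shows "(collapsible_into_blocks d p M B C \<and> collapsible_into_blocks d p M A C
            \<longleftrightarrow> mutually_independent d p A B C) \<and>
         (collapsible_into_blocks d p M B C \<and> collapsible_into_blocks d p M A B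
            \<longleftrightarrow> mutually_independent d p A B C) \<and>
         (collapsible_into_blocks d p M A C \<and> collapsible_into_blocks d p M A B
            \<longleftrightarrow> mutually_independent d p A B C)"
proof -
  have M: "M = A \<union> B \<union> C"
    using partition_onD1[OF assms(4)] by (simp add: Un_assoc)
  have ne: "A \<noteq> {}" "B \<noteq> {}" "C \<noteq> {}"
    using partition_onD3[OF assms(4)] by auto
  have disj: "A \<inter> B = {}" "A \<inter> C = {}" "B \<inter> C = {}"
    using disjointD[OF partition_onD2[OF assms(4)]] assms(5-7) by simp_all
  have perm: "A \<union> (B \<union> C) = M" "B \<union> (A \<union> C) = M" "C \<union> (A \<union> B) = M"
    unfolding M by blast+
  have perm': "A \<union> B \<union> C = M" "A \<union> C \<union> B = M" "B \<union> C \<union> A = M"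
    unfolding M by blast+
  have disj': "A \<inter> (B \<union> C) = {}" "B \<inter> (A \<union> C) = {}" "C \<inter> (A \<union> B) = {}"
    "B \<inter> A = {}" "C \<inter> A = {}" "C \<inter> B = {}"
    using disj by blast+
  note block = collapsible_into_blocks_iff_independent[OF assms(1,2)]
  have col: "collapsible_into_blocks d p M B C \<longleftrightarrow> independent d p A (B \<union> C)"
    "collapsible_into_blocks d p M A C \<longleftrightarrow> independent d p B (A \<union> C)"
    "collapsible_into_blocks d p M A B \<longleftrightarrow> independent d p C (A \<union> B)"
    using block[OF _ disj'(1) ne(1)] block[OF _ disj'(2) ne(2)] block[OF _ disj'(3) ne(3)]
    by (simp_all only: perm assms(3))
  have sym: "mutually_independent d p A C B \<longleftrightarrow> mutually_independent d p A B C"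
    "mutually_independent d p B C A \<longleftrightarrow> mutually_independent d p A B C"
    by (simp_all only: mutually_independent_def perm' mult.assoc mult.commute mult.left_commute)
  note mutual = mutually_independent_iff_independent[OF assms(1,2)]
  have "mutually_independent d p A B C \<longleftrightarrow>
      independent d p A (B \<union> C) \<and> independent d p B (A \<union> C)"
    using mutual[OF _ disj(1,2,3)] by (simp only: perm' assms(3))
  moreover have "mutually_independent d p A C B \<longleftrightarrow>
      independent d p A (B \<union> C) \<and> independent d p C (A \<union> B)"
    using mutual[OF _ disj(2,1) disj'(6)] by (simp only: perm' assms(3) Un_commute[of C B])
  moreover have "mutually_independent d p B C A \<longleftrightarrow>
      independent d p B (A \<union> C) \<and> independent d p C (A \<union> B)"
    using mutual[OF _ disj(3) disj'(4,5)]
    by (simp only: perm' assms(3) Un_commute[of C A] Un_commute[of B A])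
  ultimately show ?thesis
    unfolding col sym by simp
qed

end
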